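(* Let $k$ be an algebraically closed field of characteristic $p>0$, let $q=p^e$ with $e>0$, and let $X\subset\mathbb P^n_k$ be an extremal hypersurface of degree $q+1$. Suppose $\ell_1$ and $\ell_2$ are (distinct) intersecting lines contained in $X$, and let $\Lambda$ be the plane they span. If $\Lambda$ is not contained in $X$, then the plane section $\Lambda\cap X$ is either a perfect star of degree $q+1$ or the union of a $q$-fold line and a reduced line.
   Context: A Frobenius form of degree $q+1$ is a homogeneous polynomial of degree $q+1$ in $k[x_0,\dots,x_n]$ lying in the ideal $\langle x_0^q,\dots,x_n^q\rangle$, where $q=p^e$ with $e>0$. An extremal hypersurface is a projective hypersurface defined by a (not necessarily reduced) Frobenius form. A configuration of lines in the projective plane is a perfect star of degree $d\geq 3$ if it is projectively equivalent to $d$ reduced concurrent lines with slopes ranging through the $d$-th roots of unity; equivalently, it is defined, in suitable linear coordinates, by an equation $x^d-y^d$, where the characteristic of the ground field does not divide $d$. The plane section $\Lambda\cap X$ is considered as a scheme, i.e. as the plane curve defined by the restriction of the equation of $X$ to $\Lambda\cong\mathbb P^2$. *)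

theory Defs
  imports "HOL-Analysis.Analysis" "HOL-Computational_Algebra.Computational_Algebra"
    "HOL-Library.Poly_Mapping"
begin

text \<open>
  Polynomials over \<open>'k\<close> in variables indexed by the finite type \<open>'n\<close>; the ring
  \<open>k[x\<^sub>0,\<dots>,x\<^sub>n]\<close> is the case \<open>CARD('n) = n + 1\<close>.  The projective space is that of
  one-dimensional subspaces of \<open>'k ^ 'n\<close>, and projective linear subspaces are
  represented by the linear subspaces of \<open>'k ^ 'n\<close> they come from.
\<close>

type_synonym ('n, 'k) mpoly = "('n \<Rightarrow>\<^sub>0 nat) \<Rightarrow>\<^sub>0 'k"

definition Const :: "'k \<Rightarrow> ('n, 'k::zero) mpoly"
  where "Const c = Poly_Mapping.single 0 c"

definition X :: "'n \<Rightarrow> ('n, 'k::zero_neq_one) mpoly"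
  where "X i = Poly_Mapping.single (Poly_Mapping.single i 1) 1"

definition mpeval :: "('n::finite, 'k::comm_semiring_1) mpoly \<Rightarrow> 'k ^ 'n \<Rightarrow> 'k"
  where "mpeval F v =
    (\<Sum>m\<in>Poly_Mapping.keys F. Poly_Mapping.lookup F m * (\<Prod>i\<in>UNIV. (v $ i) ^ Poly_Mapping.lookup m i))"

definition mpsubst :: "('n \<Rightarrow> ('m, 'k) mpoly) \<Rightarrow> ('n::finite, 'k::comm_semiring_1) mpoly \<Rightarrow> ('m, 'k) mpoly"
  where "mpsubst g F =
    (\<Sum>m\<in>Poly_Mapping.keys F. Const (Poly_Mapping.lookup F m) * (\<Prod>i\<in>UNIV. g i ^ Poly_Mapping.lookup m i))"

definition linear_form :: "'k ^ 'n \<Rightarrow> ('n::finite, 'k::comm_semiring_1) mpoly"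
  where "linear_form a = (\<Sum>i\<in>UNIV. Const (a $ i) * X i)"

text \<open>The polynomial \<open>F \<circ> (y \<mapsto> A y)\<close>.\<close>

definition pullback :: "'k ^ 'm ^ 'n \<Rightarrow> ('n::finite, 'k::comm_semiring_1) mpoly \<Rightarrow> ('m::finite, 'k) mpoly"
  where "pullback A F = mpsubst (\<lambda>i. linear_form (A $ i)) F"

definition homogeneous :: "nat \<Rightarrow> ('n::finite, 'k::zero) mpoly \<Rightarrow> bool"
  where "homogeneous d F \<longleftrightarrow>
    (\<forall>m\<in>Poly_Mapping.keys F. (\<Sum>i\<in>UNIV. Poly_Mapping.lookup m i) = d)"

definition frobenius_form :: "nat \<Rightarrow> ('n::finite, 'k::comm_ring_1) mpoly \<Rightarrow> bool"
  where "frobenius_form q F \<longleftrightarrow>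
    homogeneous (q + 1) F \<and> F \<in> {\<Sum>i\<in>UNIV. g i * X i ^ q |g. True}"

text \<open>
  A hypersurface is a scheme, possibly non-reduced, so it is represented by its
  equation, which is determined up to a nonzero scalar.
\<close>

definition extremal_hypersurface :: "nat \<Rightarrow> ('n::finite, 'k::comm_ring_1) mpoly \<Rightarrow> bool"
  where "extremal_hypersurface q F \<longleftrightarrow> F \<noteq> 0 \<and> frobenius_form q F"

definition proj_line :: "('k::field ^ 'n::finite) set \<Rightarrow> bool"
  where "proj_line L \<longleftrightarrow> vec.subspace L \<and> vec.dim L = 2"

definition contained_in_hypersurface :: "('k::comm_semiring_1 ^ 'n::finite) set \<Rightarrow> ('n, 'k) mpoly \<Rightarrow> bool"
  where "contained_in_hypersurface L F \<longleftrightarrow> (\<forall>v\<in>L. mpeval F v = 0)"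

definition plane_coordinates :: "'k ^ 3 ^ 'n \<Rightarrow> ('k::field ^ 'n::finite) set \<Rightarrow> bool"
  where "plane_coordinates B L \<longleftrightarrow> inj ((*v) B) \<and> (*v) B ` UNIV = L"

text \<open>
  The following two predicates are about plane curves given by a ternary form; both
  allow for the equation to be changed by a nonzero scalar (in the second one the scalar
  is absorbed by \<open>b\<close>).  The three coordinates are \<open>X 1\<close>, \<open>X 2\<close>, \<open>X 3\<close>.
\<close>

definition perfect_star :: "nat \<Rightarrow> (3, 'k::field) mpoly \<Rightarrow> bool"
  where "perfect_star d G \<longleftrightarrow> d \<ge> 3 \<and> \<not> CHAR('k) dvd d \<and>
    (\<exists>(A :: 'k ^ 3 ^ 3) c. invertible A \<and> c \<noteq> 0 \<and> pullback A G = Const c * (X 1 ^ d - X 2 ^ d))"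

definition multiple_line_and_reduced_line :: "nat \<Rightarrow> (3, 'k::field) mpoly \<Rightarrow> bool"
  where "multiple_line_and_reduced_line q G \<longleftrightarrow>
    (\<exists>a b. a \<noteq> b \<and> vec.independent {a, b} \<and> G = linear_form a ^ q * linear_form b)"

end

theory Submission
  imports Defs
begin

text \<open>
  A Frobenius form is \<open>F(v) = h(v, v)\<close> for a form \<open>h\<close> that is \<open>q\<close>-semilinear in the first
  and linear in the second argument. If \<open>u\<close> spans the common point of the two lines and
  the lines are spanned by \<open>u, v\<^sub>1\<close> and by \<open>u, v\<^sub>2\<close>, then the vanishing of \<open>F\<close> on them kills
  all values of \<open>h\<close> on these vectors except \<open>\<alpha> = h(v\<^sub>1, v\<^sub>2)\<close> and \<open>\<beta> = h(v\<^sub>2, v\<^sub>1)\<close>. Hence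
  \<open>F(x v\<^sub>1 + y v\<^sub>2 + z u) = \<alpha> x\<^sup>q y + \<beta> x y\<^sup>q\<close>, which is a \<open>q\<close>-fold line and a line if
  \<open>\<alpha>\<close> or \<open>\<beta>\<close> vanishes, and otherwise a perfect star. The ground field is infinite, so
  identities of polynomials can be checked on values.
\<close>

section \<open>Polynomial identities over infinite fields\<close>

lemma infinite_UNIV_alg_closed: "infinite (UNIV :: 'k::alg_closed_field set)"
proof
  assume fin: "finite (UNIV :: 'k set)"
  \<comment> \<open>The product vanishes at every point of a finite field, so \<open>P\<close> is
    nonconstant but takes only the value 1.\<close>
  define P :: "'k poly" where "P = (\<Prod>a\<in>UNIV. [:-a, 1:]) + 1"
  have d: "degree (\<Prod>a\<in>(UNIV::'k set). [:-a, 1:]) = card (UNIV :: 'k set)"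
    by (subst degree_prod_eq_sum_degree) auto
  have c: "card (UNIV :: 'k set) > 0"
    using fin by (simp add: card_gt_0_iff)
  have "degree P = card (UNIV :: 'k set)"
    unfolding P_def using d c by (subst degree_add_eq_left) auto
  with c obtain x where "poly P x = 0"
    using alg_closed_imp_poly_has_root by metis
  moreover have "poly P x = 1"
    using fin by (simp add: P_def poly_prod)
  ultimately show False by simp
qed

lemma poly_eq_0_if_infinite:
  assumes "infinite (UNIV :: 'k::idom set)" and "\<And>x::'k. poly p x = 0"
  shows "p = 0"
  using assms poly_roots_finite[of p] by auto

lemma exists_power_neq:
  assumes "infinite (UNIV :: 'k::idom set)" and "a \<noteq> b"
  shows "\<exists>t::'k. t ^ a \<noteq> t ^ b"
proof (rule ccontr)
  assume "\<not> ?thesis"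
  then have "monom 1 a - monom 1 b = (0 :: 'k poly)"
    by (intro poly_eq_0_if_infinite[OF assms(1)]) (auto simp: poly_monom)
  then show False
    using assms(2) by (metis eq_iff_diff_eq_0 monom_eq_iff' zero_neq_one)
qed

text \<open>Used with exponents \<open>q\<close> and 1 to separate the two mixed values of the
  polarised form.\<close>

lemma binomial_coeffs_eq_0:
  fixes b c :: "'k::idom"
  assumes "infinite (UNIV :: 'k set)" and "m \<noteq> n" and "\<And>s. s ^ m * b + s ^ n * c = 0"
  shows "b = 0" "c = 0"
proof -
  have "monom b m + monom c n = 0"
    using assms(3)
    by (intro poly_eq_0_if_infinite[OF assms(1)]) (auto simp: poly_monom mult.commute)
  then have "coeff (monom b m + monom c n) m = 0" "coeff (monom b m + monom c n) n = 0"
    by auto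
  then show "b = 0" "c = 0"
    using assms(2) by auto
qed

lemma CHAR_power_gt_1:
  assumes "CHAR('k::idom) > 0" and "e > 0"
  shows "CHAR('k) ^ e > 1"
  using prime_gt_1_nat[OF prime_CHAR_semidom[OF assms(1)]] assms(2) by (rule one_less_power)

subsection \<open>Evaluation of polynomials\<close>

text \<open>Naming the product inside \<open>mpeval\<close> lets it be treated as a character:
  multiplicative in \<open>v\<close> for coordinatewise products, and turning sums of exponents into
  products.\<close>

definition monom_eval :: "('n::finite \<Rightarrow>\<^sub>0 nat) \<Rightarrow> 'k::comm_semiring_1 ^ 'n \<Rightarrow> 'k"
  where "monom_eval m v = (\<Prod>i\<in>UNIV. (v $ i) ^ Poly_Mapping.lookup m i)"

lemma monom_eval_0 [simp]: "monom_eval 0 v = 1"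
  by (simp add: monom_eval_def)

lemma monom_eval_single [simp]: "monom_eval (Poly_Mapping.single i n) v = (v $ i) ^ n"
proof -
  have "monom_eval (Poly_Mapping.single i n) v = (\<Prod>j\<in>UNIV. if j = i then (v $ i) ^ n else 1)"
    unfolding monom_eval_def by (intro prod.cong) (auto simp: lookup_single when_def)
  then show ?thesis by simp
qed

lemma monom_eval_add: "monom_eval (m + n) v = monom_eval m v * monom_eval n v"
  by (simp add: monom_eval_def lookup_add power_add prod.distrib)

lemma monom_eval_mult: "monom_eval m (\<chi> i. v $ i * w $ i) = monom_eval m v * monom_eval m w"
  by (simp add: monom_eval_def power_mult_distrib prod.distrib)

lemma monom_eval_one [simp]: "monom_eval m (\<chi> i. 1) = 1"
  by (simp add: monom_eval_def)

lemma mpeval_superset: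
  assumes "finite S" "Poly_Mapping.keys F \<subseteq> S"
  shows "mpeval F v = (\<Sum>m\<in>S. Poly_Mapping.lookup F m * monom_eval m v)"
  unfolding mpeval_def monom_eval_def
  by (intro sum.mono_neutral_left assms) (auto simp: in_keys_iff)

lemma mpeval_0 [simp]: "mpeval 0 v = 0"
  by (simp add: mpeval_def)

lemma mpeval_single [simp]: "mpeval (Poly_Mapping.single m c) v = c * monom_eval m v"
  by (subst mpeval_superset[of "{m}"]) auto

lemma mpeval_add [simp]: "mpeval (F + G) v = mpeval F v + mpeval G v"
proof -
  let ?S = "Poly_Mapping.keys F \<union> Poly_Mapping.keys G"
  have "Poly_Mapping.keys (F + G) \<subseteq> ?S"
    by (rule keys_add)
  then show ?thesis
    by (simp add: mpeval_superset[of ?S] lookup_add distrib_right sum.distrib)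
qed

lemma mpeval_sum [simp]: "mpeval (\<Sum>i\<in>I. f i) v = (\<Sum>i\<in>I. mpeval (f i) v)"
  by (induction I rule: infinite_finite_induct) auto

lemma mpeval_diff [simp]:
  fixes F G :: "('n::finite, 'k::comm_ring_1) mpoly"
  shows "mpeval (F - G) v = mpeval F v - mpeval G v"
  using mpeval_add[of "F - G" G v] by (simp add: algebra_simps)

lemma poly_mapping_eq_sum_single:
  "F = (\<Sum>m\<in>Poly_Mapping.keys F. Poly_Mapping.single m (Poly_Mapping.lookup F m))"
  by (rule poly_mapping_eqI)
    (auto simp: lookup_sum lookup_single when_def in_keys_iff)

lemma mpeval_mult [simp]: "mpeval (F * G) v = mpeval F v * mpeval G v"
proof -
  have "F * G = (\<Sum>m\<in>Poly_Mapping.keys F. \<Sum>n\<in>Poly_Mapping.keys G.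
      Poly_Mapping.single (m + n) (Poly_Mapping.lookup F m * Poly_Mapping.lookup G n))"
    by (subst (1) poly_mapping_eq_sum_single, subst (3) poly_mapping_eq_sum_single)
      (simp add: sum_product mult_single)
  then show ?thesis
    by (simp add: mpeval_def[of F] mpeval_def[of G] sum_product monom_eval_add
        mult_ac flip: monom_eval_def)
qed

lemma mpeval_Const [simp]: "mpeval (Const c) v = c"
  by (simp add: Const_def)

lemma mpeval_X [simp]: "mpeval (X i) v = v $ i"
  by (simp add: X_def)

lemma mpeval_1 [simp]: "mpeval 1 v = 1"
  using mpeval_Const[of 1 v] by (simp add: Const_def)

lemma mpeval_power [simp]: "mpeval (F ^ n) v = mpeval F v ^ n"
  by (induction n) auto

lemma mpeval_prod [simp]: "mpeval (\<Prod>i\<in>I. f i) v = (\<Prod>i\<in>I. mpeval (f i) v)"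
  by (induction I rule: infinite_finite_induct) auto

lemma mpeval_linear_form [simp]: "mpeval (linear_form a) v = (\<Sum>i\<in>UNIV. a $ i * v $ i)"
  by (simp add: linear_form_def)

lemma mpeval_pullback [simp]: "mpeval (pullback A F) v = mpeval F (A *v v)"
  by (simp add: pullback_def mpsubst_def mpeval_def[of F] matrix_vector_mult_def)

text \<open>Dedekind's independence of characters, for the characters \<open>v \<mapsto> v\<^sup>m\<close>.\<close>
lemma monom_eval_independent:
  fixes c :: "('n::finite \<Rightarrow>\<^sub>0 nat) \<Rightarrow> 'k::idom"
  assumes "infinite (UNIV :: 'k set)" and "finite S"
    and "\<And>v. (\<Sum>m\<in>S. c m * monom_eval m v) = 0" and "m \<in> S"
  shows "c m = 0"
  using assms(2-4)
\<comment> \<open>The coefficients vary because the induction hypothesis is applied to a modified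
  relation.\<close>
proof (induction S arbitrary: c m rule: finite_induct)
  case empty
  then show ?case by simp
next
  case (insert n S)
  have zero: "c k = 0" if k: "k \<in> S" for k
  proof -
    have "k \<noteq> n" using k insert.hyps by auto
    \<comment> \<open>A vector \<open>w\<close> is sought at which the characters of
      \<open>k\<close> and \<open>n\<close> differ. Changing one coordinate of the all-ones vector,
      at an index where the exponents differ, suffices.\<close>
    then obtain i where "Poly_Mapping.lookup k i \<noteq> Poly_Mapping.lookup n i"
      using poly_mapping_eqI[of k n] by auto
    then obtain t :: 'k where t: "t ^ Poly_Mapping.lookup k i \<noteq> t ^ Poly_Mapping.lookup n i"
      using exists_power_neq[OF assms(1)] by blast
    define w :: "'k ^ 'n" where "w = (\<chi> j. if j = i then t else 1)"
    have "monom_eval l w = (\<Prod>j\<in>UNIV. if j = i then t ^ Poly_Mapping.lookup l i else 1)" for l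
      unfolding monom_eval_def w_def by (intro prod.cong) auto
    then have w: "monom_eval l w = t ^ Poly_Mapping.lookup l i" for l
      by simp
    \<comment> \<open>The relation at the coordinatewise product of \<open>v\<close> and
      \<open>w\<close>, minus \<open>monom_eval n w\<close> times the relation at \<open>v\<close>,
      no longer involves \<open>n\<close>.\<close>
    have "(\<Sum>m\<in>S. c m * (monom_eval m w - monom_eval n w) * monom_eval m v) = 0" for v
    proof -
      have 1: "c n * monom_eval n v + (\<Sum>m\<in>S. c m * monom_eval m v) = 0"
        using insert.prems(1)[of v] insert.hyps by simp
      have 2: "c n * (monom_eval n v * monom_eval n w)
          + (\<Sum>m\<in>S. c m * (monom_eval m v * monom_eval m w)) = 0"
        using insert.prems(1)[of "\<chi> i. v $ i * w $ i"] insert.hyps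
        by (simp add: monom_eval_mult)
      have "(\<Sum>m\<in>S. c m * (monom_eval m w - monom_eval n w) * monom_eval m v)
          = (\<Sum>m\<in>S. c m * (monom_eval m v * monom_eval m w))
            - monom_eval n w * (\<Sum>m\<in>S. c m * monom_eval m v)"
        by (simp add: sum_distrib_left left_diff_distrib right_diff_distrib sum_subtractf mult_ac)
      also have "\<dots> = - (c n * (monom_eval n v * monom_eval n w))
          - monom_eval n w * - (c n * monom_eval n v)"
        using 1[THEN eq_neg_iff_add_eq_0[THEN iffD2]] 2[THEN eq_neg_iff_add_eq_0[THEN iffD2]]
        by simp
      finally show ?thesis by simp
    qed
    from insert.IH[OF this k] show ?thesis
      using t w by simp
  qed
  then have "c n = 0"
    using insert.prems(1)[of "\<chi> i. 1"] insert.hyps by simp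
  with zero insert.prems(2) show ?case by auto
qed

lemma mpoly_eqI:
  fixes F G :: "('n::finite, 'k::idom) mpoly"
  assumes "infinite (UNIV :: 'k set)" and "\<And>v. mpeval F v = mpeval G v"
  shows "F = G"
proof -
  have "Poly_Mapping.lookup (F - G) m = 0" for m
  proof (cases "m \<in> Poly_Mapping.keys (F - G)")
    case True
    have "(\<Sum>m\<in>Poly_Mapping.keys (F - G). Poly_Mapping.lookup (F - G) m * monom_eval m v) = 0" for v
      using assms(2)[of v] mpeval_diff[of F G v]
      unfolding mpeval_def[of "F - G"] monom_eval_def by simp
    then show ?thesis
      using monom_eval_independent[OF assms(1) finite_keys _ True] by blast
  qed (simp add: in_keys_iff)
  then have "F - G = 0"
    by (intro poly_mapping_eqI) simp
  then show ?thesis by simp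
qed

subsection \<open>Frobenius forms\<close>

text \<open>Comparing degrees, a Frobenius form only involves the monomials
  \<open>x\<^sub>i\<^sup>q x\<^sub>j\<close>; polarising them gives a form that is \<open>q\<close>-semilinear in the first argument.\<close>

lemma frobenius_form_keys:
  fixes F :: "('n::finite, 'k::comm_ring_1) mpoly"
  assumes "frobenius_form q F" and m: "m \<in> Poly_Mapping.keys F"
  shows "\<exists>i j. m = Poly_Mapping.single i q + Poly_Mapping.single j 1"
proof -
  obtain g where F: "F = (\<Sum>i\<in>UNIV. g i * X i ^ q)"
    using assms(1) unfolding frobenius_form_def by auto
  have deg: "(\<Sum>i\<in>UNIV. Poly_Mapping.lookup m i) = q + 1"
    using assms unfolding frobenius_form_def homogeneous_def by auto
  have Xq: "(X i :: ('n, 'k) mpoly) ^ k = Poly_Mapping.single (Poly_Mapping.single i k) 1" for i k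
    by (induction k) (simp_all add: X_def mult_single flip: single_add)
  \<comment> \<open>A monomial of the sum occurs in some summand, so it is divisible by
    \<open>X i ^ q\<close>; the cofactor has degree 1 and is a variable.\<close>
  obtain i where "m \<in> Poly_Mapping.keys (g i * X i ^ q)"
    using m keys_sum[of "\<lambda>i. g i * X i ^ q" UNIV] unfolding F by auto
  then obtain n where n: "m = Poly_Mapping.single i q + n"
    using keys_mult[of "g i" "X i ^ q"] unfolding Xq
    by (auto split: if_splits simp: add.commute)
  have "(\<Sum>j\<in>UNIV. Poly_Mapping.lookup (Poly_Mapping.single i q) j) = q"
    by (simp add: lookup_single when_def)
  with deg have dn: "(\<Sum>j\<in>UNIV. Poly_Mapping.lookup n j) = 1"
    by (simp add: n lookup_add sum.distrib)
  then obtain j where j: "Poly_Mapping.lookup n j = 1" "\<forall>k. k \<noteq> j \<longrightarrow> Poly_Mapping.lookup n k = 0"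
    using sum_eq_1_iff[of UNIV "Poly_Mapping.lookup n"] by auto
  then have "n = Poly_Mapping.single j 1"
    by (intro poly_mapping_eqI) (auto simp: lookup_single when_def)
  with n show ?thesis by blast
qed

definition frobenius_sesquilinear :: "nat \<Rightarrow> ('k::comm_ring_1 ^ 'n \<Rightarrow> 'k ^ 'n \<Rightarrow> 'k) \<Rightarrow> bool"
  where "frobenius_sesquilinear q h \<longleftrightarrow>
    (\<forall>u v w. h (u + v) w = h u w + h v w) \<and> (\<forall>u v w. h u (v + w) = h u v + h u w) \<and>
    (\<forall>c v w. h (c *s v) w = c ^ q * h v w) \<and> (\<forall>c v w. h v (c *s w) = c * h v w)"

lemma frobenius_sesquilinearD:
  assumes "frobenius_sesquilinear q h"
  shows "h (u + v) w = h u w + h v w" "h u (v + w) = h u v + h u w"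
    "h (c *s v) w = c ^ q * h v w" "h v (c *s w) = c * h v w"
  using assms unfolding frobenius_sesquilinear_def by blast+

lemma frobenius_form_polarisation:
  fixes F :: "('n::finite, 'k::idom) mpoly"
  assumes "frobenius_form q F" and "CHAR('k) > 0" and q: "q = CHAR('k) ^ e"
  shows "\<exists>h. frobenius_sesquilinear q h \<and> (\<forall>v. mpeval F v = h v v)"
proof -
  obtain i j where ij:
    "\<And>m. m \<in> Poly_Mapping.keys F \<Longrightarrow> m = Poly_Mapping.single (i m) q + Poly_Mapping.single (j m) 1"
    using frobenius_form_keys[OF assms(1)] by metis
  have frob: "(x + y) ^ q = x ^ q + y ^ q" for x y :: 'k
    using freshmans_dream'[OF prime_CHAR_semidom[OF assms(2)] q] .
  define h where
    "h v w = (\<Sum>m\<in>Poly_Mapping.keys F. Poly_Mapping.lookup F m * (v $ i m ^ q * w $ j m))"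
    for v w :: "'k ^ 'n"
  have "mpeval F v = h v v" for v
  proof -
    have "monom_eval m v = v $ i m ^ q * v $ j m" if "m \<in> Poly_Mapping.keys F" for m
      by (subst ij[OF that]) (simp add: monom_eval_add del: single_add)
    then show ?thesis
      by (simp add: mpeval_def h_def flip: monom_eval_def)
  qed
  moreover have "h (u + v) w = h u w + h v w" "h u (v + w) = h u v + h u w" for u v w
    by (simp_all add: h_def frob distrib_left distrib_right sum.distrib)
  moreover have "h (c *s v) w = c ^ q * h v w" "h v (c *s w) = c * h v w" for c v w
    by (simp_all add: h_def sum_distrib_left power_mult_distrib mult_ac)
  ultimately show ?thesis
    unfolding frobenius_sesquilinear_def by blast
qed

subsection \<open>Two lines through a point\<close>

lemma proj_line_eq_span:
  assumes "proj_line L" and "u \<in> L" "u \<noteq> 0"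
  obtains v where "L = vec.span {u, v}"
proof -
  have sub: "vec.subspace L" and dim: "vec.dim L = 2"
    using assms(1) by (auto simp: proj_line_def)
  have "vec.independent {u}" using assms(3) by simp
  then obtain C where C: "{u} \<subseteq> C" "C \<subseteq> L" "vec.independent C" "L \<subseteq> vec.span C"
    using vec.maximal_independent_subset_extend[of "{u}" L] assms(2) by auto
  then have "card C = 2"
    using vec.basis_card_eq_dim dim by metis
  with C(1) obtain v where "C = {u, v}"
    by (auto simp: card_2_iff)
  with C sub have "L = vec.span {u, v}"
    using vec.span_minimal[of C L] by auto
  then show thesis by (rule that)
qed

lemma in_span_pair: "x \<in> vec.span {u, v} \<longleftrightarrow> (\<exists>s t. x = s *s u + t *s v)"
  by (auto simp: vec.span_insert vec.span_singleton algebra_simps)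

lemma in_span_triple:
  "x \<in> vec.span {u, v, w} \<longleftrightarrow> (\<exists>r s t. x = r *s u + s *s v + t *s w)"
  unfolding vec.span_insert[of u] in_span_pair mem_Collect_eq
  by (auto simp: algebra_simps)

text \<open>The matrix is given by its rows; its columns are \<open>P\<close>, \<open>Q\<close>,
  \<open>R\<close>.\<close>

lemma mat_3_mult:
  fixes P Q R :: "'k::field ^ 'n" and y :: "'k ^ 3"
  shows "(\<chi> i. vector [P $ i, Q $ i, R $ i]) *v y
    = (y $ 1) *s P + (y $ 2) *s Q + (y $ 3) *s R"
  by (simp add: vec_eq_iff matrix_vector_mult_def sum_3 vector_3 mult.commute)

section \<open>Normal forms of the plane section\<close>

lemma exists_neq_frobenius_eq_frobenius_twice:
  assumes "CHAR('k) > 0" "e > 0" and q: "q = CHAR('k) ^ e"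
  obtains a :: "'k::alg_closed_field" where "a ^ q \<noteq> a" "(a ^ q) ^ q = a"
proof -
  have pr: "prime CHAR('k)" by (rule prime_CHAR_semidom[OF assms(1)])
  have frob: "(x + y) ^ q = x ^ q + y ^ q" for x y :: 'k
    using freshmans_dream'[OF pr q] .
  have "q > 1"
    unfolding q using assms(1,2) by (rule CHAR_power_gt_1)
  \<comment> \<open>With \<open>t ^ q = - t\<close> and \<open>a ^ q = a + t\<close>, applying
    Frobenius twice gives \<open>a + t - t = a\<close>, while \<open>t \<noteq> 0\<close> keeps
    \<open>a\<close> from being fixed by one application.\<close>
  then obtain t :: 'k where "t ^ (q - 1) = -1"
    using nth_root_exists[of "q - 1" "-1"] by auto
  then have t: "t ^ q = - t" "t \<noteq> 0"
    using \<open>q > 1\<close> by (auto simp: power_eq_if[of t q] power_0_left)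
  have "degree (monom 1 q + [:- t, -1:]) = q"
    using \<open>q > 1\<close> by (subst degree_add_eq_left) (auto simp: degree_monom_eq)
  then obtain a where "poly (monom 1 q + [:- t, -1:]) a = 0"
    using alg_closed_imp_poly_has_root[of "monom 1 q + [:- t, -1:]"] \<open>q > 1\<close> by auto
  then have "a ^ q = a + t"
    by (simp add: poly_monom algebra_simps)
  then show thesis
    using t by (intro that[of a]) (auto simp: frob)
qed

text \<open>With \<open>b = a\<^sup>q\<close> and \<open>b\<^sup>q = a\<close>, the substitution \<open>x = aX + bY\<close>, \<open>y = X + Y\<close>
  kills the mixed terms of \<open>x\<^sup>q y - x y\<^sup>q\<close>. A preliminary scaling of \<open>x\<close> brings
  \<open>\<alpha> x\<^sup>q y + \<beta> x y\<^sup>q\<close> into that shape up to a factor.\<close>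

lemma perfect_star_if_binomial:
  fixes G :: "(3, 'k::alg_closed_field) mpoly" and M :: "'k ^ 3 ^ 3"
  assumes "CHAR('k) > 0" "e > 0" and q: "q = CHAR('k) ^ e"
    and M: "invertible M"
    and G: "\<And>y. mpeval G (M *v y) = \<alpha> * (y $ 1 ^ q * y $ 2) + \<beta> * (y $ 2 ^ q * y $ 1)"
    and nz: "\<alpha> \<noteq> 0" "\<beta> \<noteq> 0"
  shows "perfect_star (q + 1) G"
proof -
  have pr: "prime CHAR('k)" by (rule prime_CHAR_semidom[OF assms(1)])
  have frob: "(x + y) ^ q = x ^ q + y ^ q" for x y :: 'k
    using freshmans_dream'[OF pr q] .
  have "q > 1"
    unfolding q using assms(1,2) by (rule CHAR_power_gt_1)
  have "CHAR('k) dvd q"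
    unfolding q using assms(2) by simp
  then have ndvd: "\<not> CHAR('k) dvd q + 1"
    using prime_gt_1_nat[OF pr] by (metis dvd_add_right_iff nat_dvd_1_iff_1 less_irrefl)
  obtain a :: 'k where a: "a ^ q \<noteq> a" "(a ^ q) ^ q = a"
    using exists_neq_frobenius_eq_frobenius_twice assms(1-3) by metis
  define b where "b = a ^ q"
  \<comment> \<open>Replacing x by \<open>l\<close> x turns the form into \<open>\<beta> * l\<close>
    times (x y^q - x^q y).\<close>
  obtain l :: 'k where "l ^ (q - 1) = - \<beta> / \<alpha>"
    using nth_root_exists[of "q - 1" "- \<beta> / \<alpha>"] \<open>q > 1\<close> by auto
  then have l': "\<alpha> * l ^ (q - 1) = - \<beta>" and "l \<noteq> 0"
    using nz \<open>q > 1\<close> by (auto simp: power_0_left)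
  have "\<alpha> * l ^ q = (\<alpha> * l ^ (q - 1)) * l"
    using \<open>q > 1\<close> by (simp add: power_eq_if[of l q] mult_ac)
  with l' \<open>l \<noteq> 0\<close> have l: "\<alpha> * l ^ q = - \<beta> * l" "l \<noteq> 0"
    by simp_all
  \<comment> \<open>The scaling by \<open>l\<close> combined with the substitution; the third
    coordinate, absent from the form, stays fixed.\<close>
  define N :: "'k ^ 3 ^ 3" where
    "N = vector [vector [l * a, l * b, 0], vector [1, 1, 0], vector [0, 0, 1]]"
  have N: "(N *v y) $ 1 = l * (a * y $ 1 + b * y $ 2)" "(N *v y) $ 2 = y $ 1 + y $ 2" for y
    by (simp_all add: N_def matrix_vector_mult_def sum_3 vector_3 algebra_simps)
  have "det N = l * (a - b)"
    by (simp add: N_def det_3 vector_3 algebra_simps)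
  then have "invertible N"
    using a l by (simp add: invertible_det_nz b_def)
  then have "invertible (M ** N)"
    using M by (rule invertible_mult[rotated])
  moreover have "\<beta> * l * (a - b) \<noteq> 0"
    using nz l a by (simp add: b_def)
  moreover have "pullback (M ** N) G = Const (\<beta> * l * (a - b)) * (X 1 ^ (q + 1) - X 2 ^ (q + 1))"
  proof (rule mpoly_eqI[OF infinite_UNIV_alg_closed])
    fix y :: "'k ^ 3"
    define s t where "s = y $ 1" and "t = y $ 2"
    have "mpeval (pullback (M ** N) G) y
        = \<alpha> * ((l * (a * s + b * t)) ^ q * (s + t)) + \<beta> * ((s + t) ^ q * (l * (a * s + b * t)))"
      using G[of "N *v y"] by (simp add: N s_def t_def matrix_vector_mul_assoc)
    also have "\<dots> = (\<alpha> * l ^ q) * ((b * s ^ q + a * t ^ q) * (s + t))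
        + \<beta> * l * ((s ^ q + t ^ q) * (a * s + b * t))"
      using a(2) by (simp add: frob power_mult_distrib b_def mult_ac)
    also have "\<dots> = \<beta> * l * (a - b) * (s ^ q * s - t ^ q * t)"
      unfolding l(1) by (simp add: algebra_simps)
    finally show "mpeval (pullback (M ** N) G) y
        = mpeval (Const (\<beta> * l * (a - b)) * (X 1 ^ (q + 1) - X 2 ^ (q + 1))) y"
      by (simp add: s_def t_def mult.commute)
  qed
  ultimately show ?thesis
    unfolding perfect_star_def using \<open>q > 1\<close> ndvd
    by (intro conjI exI[of _ "M ** N"] exI[of _ "\<beta> * l * (a - b)"]) auto
qed

text \<open>The rows of the inverse of \<open>M\<close> are the coordinate functions in the new
  basis; rows \<open>i\<close> and \<open>j\<close> give the two lines, and \<open>c\<close> is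
  absorbed into \<open>b\<close>.\<close>

lemma multiple_line_and_reduced_line_if_monomial:
  fixes G :: "(3, 'k::field) mpoly" and M :: "'k ^ 3 ^ 3"
  assumes inf: "infinite (UNIV :: 'k set)" and M: "invertible M"
    and G: "\<And>y. mpeval G (M *v y) = c * (y $ i ^ q * y $ j)"
    and "c \<noteq> 0" "i \<noteq> j"
  shows "multiple_line_and_reduced_line q G"
proof -
  obtain C where MC: "M ** C = mat 1" and CM: "C ** M = mat 1"
    using M by (auto simp: invertible_def)
  define a b where "a = C $ i" and "b = c *s (C $ j)"
  have row: "(\<Sum>k\<in>UNIV. C $ r $ k * y $ k) = (C *v y) $ r" for r y
    by (simp add: matrix_vector_mult_def)
  \<comment> \<open>Columns \<open>j\<close> and \<open>i\<close> of \<open>M\<close> are dual to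
    these rows of \<open>C\<close>, which shows the two linear forms independent.\<close>
  have "\<exists>y. (C *v y) $ j = 1 \<and> (C *v y) $ i = 0"
    using \<open>i \<noteq> j\<close> by (intro exI[of _ "M *v axis j 1"])
      (simp add: matrix_vector_mul_assoc CM axis_def)
  then obtain y where y: "(C *v y) $ j = 1" "(C *v y) $ i = 0" by blast
  have "\<exists>z. (C *v z) $ j = 0 \<and> (C *v z) $ i = 1"
    using \<open>i \<noteq> j\<close> by (intro exI[of _ "M *v axis i 1"])
      (simp add: matrix_vector_mul_assoc CM axis_def)
  then obtain z where z: "(C *v z) $ j = 0" "(C *v z) $ i = 1" by blast
  have "b \<noteq> 0"
  proof
    assume "b = 0"
    then have "C $ j = 0" using \<open>c \<noteq> 0\<close> by (simp add: b_def)
    then show False using y row[of j y] by simp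
  qed
  moreover have notin: "a \<notin> vec.span {b}"
  proof
    assume "a \<in> vec.span {b}"
    then obtain k where "a = (k * c) *s (C $ j)"
      by (auto simp: vec.span_singleton b_def)
    then have "(C *v x) $ i = k * c * (C *v x) $ j" for x
      by (simp add: a_def sum_distrib_left mult.assoc flip: row)
    from this[of z] show False using z by simp
  qed
  ultimately have "vec.independent {a, b}" "a \<noteq> b"
    using vec.span_base[of b "{b}"] by (auto simp: vec.independent_insert)
  moreover have "G = linear_form a ^ q * linear_form b"
  proof (rule mpoly_eqI[OF inf])
    fix y :: "'k ^ 3"
    have "M *v (C *v y) = y"
      by (simp add: matrix_vector_mul_assoc MC)
    moreover have b: "mpeval (linear_form b) y = c * (C *v y) $ j"
      by (simp add: b_def sum_distrib_left mult.assoc flip: row)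
    ultimately have "mpeval G y = c * ((C *v y) $ i ^ q * (C *v y) $ j)"
      using G[of "C *v y"] by simp
    also have "(C *v y) $ i = mpeval (linear_form a) y"
      by (simp add: a_def row)
    finally show "mpeval G y = mpeval (linear_form a ^ q * linear_form b) y"
      using b by (simp add: mult_ac)
  qed
  ultimately show ?thesis
    unfolding multiple_line_and_reduced_line_def by blast
qed

section \<open>The plane spanned by two intersecting lines\<close>

theorem proposition8p12:
  fixes F :: "('n::finite, 'k::alg_closed_field) mpoly"
    and L1 L2 \<Lambda> :: "('k ^ 'n) set"
    and B :: "'k ^ 3 ^ 'n"
    and p q e :: nat
  assumes "p = CHAR('k)" "p > 0"
    and "e > 0" "q = p ^ e"
    and "extremal_hypersurface q F"
    and "proj_line L1" "proj_line L2" "L1 \<noteq> L2"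
    and "L1 \<inter> L2 \<noteq> {0}"
    and "contained_in_hypersurface L1 F" "contained_in_hypersurface L2 F"
    and "\<Lambda> = vec.span (L1 \<union> L2)"
    and "\<not> contained_in_hypersurface \<Lambda> F"
    and "plane_coordinates B \<Lambda>"
  shows "perfect_star (q + 1) (pullback B F) \<or>
         multiple_line_and_reduced_line q (pullback B F)"
proof -
  note inf = infinite_UNIV_alg_closed[where ?'k = 'k]
  have char: "CHAR('k) > 0" and q: "q = CHAR('k) ^ e"
    using assms(1,2,4) by auto
  have "q > 1"
    unfolding q using char assms(3) by (rule CHAR_power_gt_1)
  have form: "frobenius_form q F"
    using assms(5) by (simp add: extremal_hypersurface_def)
  obtain h where sesq: "frobenius_sesquilinear q h" and F: "\<And>v. mpeval F v = h v v"
    using frobenius_form_polarisation[OF form char q] by blast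
  note h = frobenius_sesquilinearD[OF sesq]
  have "0 \<in> L1 \<inter> L2"
    using assms(6,7) vec.subspace_0 by (auto simp: proj_line_def)
  then obtain u where u: "u \<in> L1" "u \<in> L2" "u \<noteq> 0"
    using assms(9) by auto
  obtain v1 where L1: "L1 = vec.span {u, v1}"
    using proj_line_eq_span[OF assms(6) u(1,3)] .
  obtain v2 where L2: "L2 = vec.span {u, v2}"
    using proj_line_eq_span[OF assms(7) u(2,3)] .
  \<comment> \<open>Expanding \<open>h\<close> at \<open>s *s u + v\<close> leaves
    \<open>s ^ q * h u v + s * h v u\<close>, which vanishes for all \<open>s\<close>; since
    \<open>q > 1\<close>, both coefficients are zero.\<close>
  have isotropic: "h u u = 0 \<and> h u v = 0 \<and> h v u = 0 \<and> h v v = 0"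
    if "contained_in_hypersurface (vec.span {u, v}) F" for v
  proof -
    have zero: "h (s *s u + t *s v) (s *s u + t *s v) = 0" for s t
    proof -
      have "s *s u + t *s v \<in> vec.span {u, v}"
        unfolding in_span_pair by blast
      with that show ?thesis
        by (simp add: contained_in_hypersurface_def F)
    qed
    have uu: "h u u = 0" using zero[of 1 0] \<open>q > 1\<close> by (simp add: h)
    have vv: "h v v = 0" using zero[of 0 1] \<open>q > 1\<close> by (simp add: h)
    have "s ^ q * h u v + s ^ 1 * h v u = 0" for s
      using zero[of s 1] uu vv by (simp add: h add.commute)
    from binomial_coeffs_eq_0[OF inf _ this] \<open>q > 1\<close> uu vv show ?thesis by simp
  qed
  have iso: "h u u = 0" "h u v1 = 0" "h v1 u = 0" "h v1 v1 = 0"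
    "h u v2 = 0" "h v2 u = 0" "h v2 v2 = 0"
    using isotropic[of v1] isotropic[of v2] assms(10,11) unfolding L1 L2 by auto
  define \<alpha> \<beta> where "\<alpha> = h v1 v2" and "\<beta> = h v2 v1"
  have eval: "mpeval F (x *s v1 + y *s v2 + z *s u) = \<alpha> * (x ^ q * y) + \<beta> * (y ^ q * x)"
    for x y z
    unfolding F by (simp add: h iso \<alpha>_def \<beta>_def)
  \<comment> \<open>The common point \<open>u\<close> comes last, so that the third coordinate is
    the one missing from the equation.\<close>
  have \<Lambda>: "\<Lambda> = vec.span {v1, v2, u}"
  proof
    show "\<Lambda> \<subseteq> vec.span {v1, v2, u}"
      unfolding assms(12) L1 L2
      by (intro vec.span_minimal Un_least vec.span_mono vec.subspace_span) auto
    show "vec.span {v1, v2, u} \<subseteq> \<Lambda>"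
      unfolding assms(12) L1 L2 by (intro vec.span_mono) (auto intro: vec.span_base)
  qed
  have nz: "\<alpha> \<noteq> 0 \<or> \<beta> \<noteq> 0"
    using assms(13) eval by (auto simp: contained_in_hypersurface_def \<Lambda> in_span_triple)
  have inj: "inj ((*v) B)" and im: "range ((*v) B) = \<Lambda>"
    using assms(14) by (auto simp: plane_coordinates_def)
  have "{v1, v2, u} \<subseteq> range ((*v) B)"
    unfolding im \<Lambda> by (rule vec.span_superset)
  then obtain P Q R where PQR: "B *v P = v1" "B *v Q = v2" "B *v R = u"
    by auto
  \<comment> \<open>Changes coordinates on the plane from those of \<open>B\<close> to those with
    respect to \<open>v1\<close>, \<open>v2\<close>, \<open>u\<close>.\<close>
  define M :: "'k ^ 3 ^ 3" where "M = (\<chi> i. vector [P $ i, Q $ i, R $ i])"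
  have BM: "B *v (M *v y) = y $ 1 *s v1 + y $ 2 *s v2 + y $ 3 *s u" for y
    unfolding M_def mat_3_mult by (simp add: vec.add vec.scale PQR)
  \<comment> \<open>The vectors \<open>v1\<close>, \<open>v2\<close>, \<open>u\<close> span the
    image of the injective \<open>B\<close>, so \<open>M\<close> is onto, and a square matrix that
    is onto is invertible.\<close>
  have "surj ((*v) M)"
  proof (subst surj_def, rule allI)
    fix w
    have "B *v w \<in> vec.span {v1, v2, u}"
      using im \<Lambda> by blast
    then obtain r s t where "B *v w = r *s v1 + s *s v2 + t *s u"
      unfolding in_span_triple by blast
    then have "B *v w = B *v (M *v vector [r, s, t])"
      by (simp add: BM vector_3)
    then show "\<exists>y. w = M *v y"
      using inj by (auto dest: injD)
  qed
  then have M: "invertible M"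
    by (simp add: invertible_right_inverse matrix_right_invertible_surjective)
  have G: "mpeval (pullback B F) (M *v y) = \<alpha> * (y $ 1 ^ q * y $ 2) + \<beta> * (y $ 2 ^ q * y $ 1)" for y
    by (simp add: BM eval)
  consider "\<alpha> \<noteq> 0" "\<beta> \<noteq> 0" | "\<alpha> \<noteq> 0" "\<beta> = 0" | "\<alpha> = 0" "\<beta> \<noteq> 0"
    using nz by blast
  then show ?thesis
  proof cases
    case 1
    then show ?thesis
      using perfect_star_if_binomial[OF char assms(3) q M G] by blast
  next
    case 2
    then have "mpeval (pullback B F) (M *v y) = \<alpha> * (y $ 1 ^ q * y $ 2)" for y
      using G by simp
    from multiple_line_and_reduced_line_if_monomial[OF inf M this] 2 show ?thesis by simp
  next
    case 3
    then have "mpeval (pullback B F) (M *v y) = \<beta> * (y $ 2 ^ q * y $ 1)" for y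
      using G by simp
    from multiple_line_and_reduced_line_if_monomial[OF inf M this] 3 show ?thesis by simp
  qed
qed

end
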